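(* For $p\in\omega_4$ let $\Pi(p)$ be the projective subspace spanned by the four lines $L^{ijk}(p)$, $ijk\in\{111,122,212,221\}$, and $\Pi^*(p)$ the subspace spanned by the four lines $L^{ijk}(p)$, $ijk\in\{222,211,121,112\}$. Then $\Pi(p)$ and $\Pi^*(p)$ are generators (solids, i.e. projective 3-spaces, contained in the quadric) of the hyperbolic quadric $\mathcal{H}_7$, and they belong to different systems of generators.
   Context: Work over $\mathbb{F}_2$. $V_8=V(8,2)$ with basis $e_1,\dots,e_8$, $V_a=\langle e_1,e_8\rangle$, $V_b=\langle e_2,e_7\rangle$, $V_c=\langle e_3,e_6\rangle$, $V_d=\langle e_4,e_5\rangle$; points of $\operatorname{PG}(7,2)$ are nonzero vectors; $\omega_4$ is the set of vectors all four of whose components in $V_a,\dots,V_d$ are nonzero. $\mathcal{H}_7$ is the hyperbolic quadric $Q(x)=0$ with $Q(x)=x_1x_8+x_2x_7+x_3x_6+x_4x_5+\sum_{i=1}^8x_i$; its generators (maximal totally singular subspaces, projective dimension 3) fall into two systems. Let $\zeta_a: e_1\mapsto e_8\mapsto e_1+e_8\mapsto e_1$, $\zeta_b: e_7\mapsto e_2\mapsto e_2+e_7\mapsto e_7$, $\zeta_c: e_3\mapsto e_6\mapsto e_3+e_6\mapsto e_3$, $\zeta_d: e_5\mapsto e_4\mapsto e_4+e_5\mapsto e_5$ (linear maps of $V_h$), $A_{ijk}=\zeta_a^i\oplus\zeta_b^j\oplus\zeta_c^k\oplus\zeta_d$ for $i,j,k\in\{1,2\}$, and $L^{ijk}(p)=\{p,A_{ijk}p,A_{ijk}^2p\}$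 (a line). *)

theory Defs
  imports "HOL-Analysis.Cartesian_Space" "HOL-Library.Z2"
begin

text \<open>
  The field \<open>GF(2)\<close> is the type \<^typ>\<open>bit\<close>. In the cyclic index type \<^typ>\<open>8\<close> the
  numeral \<open>8\<close> equals \<open>0\<close>, so \<open>1, \<dots>, 8\<close> are its eight distinct elements.
  A projective subspace of \<open>PG(7,2)\<close> of projective dimension \<open>d\<close> is represented by the vector
  subspace of dimension \<open>d + 1\<close> whose nonzero vectors are its points.
\<close>

type_synonym V8 = "bit ^ 8"

definition ebas :: "8 \<Rightarrow> V8" where
  "ebas i = axis i 1"

text \<open>The component of \<open>x\<close> in the summand \<open>V\<^sub>h\<close> spanned by \<open>ebas r\<close> and \<open>ebas s\<close>:\<close>

definition component :: "8 \<Rightarrow> 8 \<Rightarrow> V8 \<Rightarrow> V8" where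
  "component r s x = x $ r *s ebas r + x $ s *s ebas s"

definition omega4 :: "V8 set" where
  "omega4 = {x. component 1 8 x \<noteq> 0 \<and> component 2 7 x \<noteq> 0 \<and>
                component 3 6 x \<noteq> 0 \<and> component 4 5 x \<noteq> 0}"

definition Q :: "V8 \<Rightarrow> bit" where
  "Q x = x $ 1 * x $ 8 + x $ 2 * x $ 7 + x $ 3 * x $ 6 + x $ 4 * x $ 5 + (\<Sum>i\<in>UNIV. x $ i)"

definition H7 :: "V8 set" where
  "H7 = {x. x \<noteq> 0 \<and> Q x = 0}"

definition totally_singular :: "V8 set \<Rightarrow> bool" where
  "totally_singular U \<longleftrightarrow> vec.subspace U \<and> U - {0} \<subseteq> H7"

definition generator :: "V8 set \<Rightarrow> bool" where
  "generator U \<longleftrightarrow> totally_singular U \<and> (\<forall>W. totally_singular W \<and> U \<subseteq> W \<longrightarrow> W = U)"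

text \<open>
  The two systems of generators are the classes of the following relation on generators
  (intersection of even codimension), the usual definition for a hyperbolic quadric.
\<close>

definition same_system :: "V8 set \<Rightarrow> V8 set \<Rightarrow> bool" where
  "same_system U W \<longleftrightarrow> generator U \<and> generator W \<and> even (vec.dim U - vec.dim (U \<inter> W))"

text \<open>
  The linear map with \<open>ebas r \<mapsto> ebas s \<mapsto> ebas r + ebas s\<close> on the span of \<open>ebas r\<close> and \<open>ebas s\<close>,
  extended by zero to the whole space. The order of the arguments matters: for the second and
  fourth summand it is \<open>e\<^sub>7\<close>, respectively \<open>e\<^sub>5\<close>, that comes first.
\<close>

definition zeta :: "8 \<Rightarrow> 8 \<Rightarrow> V8 \<Rightarrow> V8" where
  "zeta r s x = x $ r *s ebas s + x $ s *s (ebas r + ebas s)"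

abbreviation "zeta_a \<equiv> zeta 1 8"
abbreviation "zeta_b \<equiv> zeta 7 2"
abbreviation "zeta_c \<equiv> zeta 3 6"
abbreviation "zeta_d \<equiv> zeta 5 4"

lemma zeta_ebas:
  assumes "r \<noteq> s"
  shows "zeta r s (ebas r) = ebas s"
    and "zeta r s (ebas s) = ebas r + ebas s"
    and "zeta r s (ebas r + ebas s) = ebas r"
  using assms by (auto simp: zeta_def ebas_def axis_def vec_eq_iff)

definition A :: "nat \<Rightarrow> nat \<Rightarrow> nat \<Rightarrow> V8 \<Rightarrow> V8" where
  "A i j k x = (zeta_a ^^ i) (component 1 8 x) + (zeta_b ^^ j) (component 2 7 x)
             + (zeta_c ^^ k) (component 3 6 x) + zeta_d (component 4 5 x)"

definition L :: "nat \<Rightarrow> nat \<Rightarrow> nat \<Rightarrow> V8 \<Rightarrow> V8 set" where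
  "L i j k p = {p, A i j k p, A i j k (A i j k p)}"

definition solid :: "V8 \<Rightarrow> V8 set" where
  "solid p = vec.span (L 1 1 1 p \<union> L 1 2 2 p \<union> L 2 1 2 p \<union> L 2 2 1 p)"

definition solid_star :: "V8 \<Rightarrow> V8 set" where
  "solid_star p = vec.span (L 2 2 2 p \<union> L 2 1 1 p \<union> L 1 2 1 p \<union> L 1 1 2 p)"

end

theory Submission
  imports Defs
begin

text \<open>
  Identify each summand \<open>V\<^sub>h\<close> with \<open>GF(4)\<close> so that \<open>\<zeta>\<^sub>h\<close> becomes multiplication by a primitive
  cube root of unity \<open>\<omega>\<close>. Then \<open>Q\<close> is the sum of the four norms, which are multiplicative, and the
  coordinatewise multiplication by \<open>p \<in> \<omega>\<^sub>4\<close> is an isometry commuting with all \<open>A\<^sub>i\<^sub>j\<^sub>k\<close>. This reduces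
  the claim to \<open>p = (1, 1, 1, 1)\<close>. There \<open>\<Pi>(p)\<close> and \<open>\<Pi>\<^sup>*(p)\<close> consist of the vectors whose four
  \<open>\<omega>\<close>-coordinates share one value \<open>t\<close> and whose four \<open>1\<close>-coordinates sum to \<open>0\<close>, respectively \<open>t\<close>.
  Both are their own orthogonal complement, and they meet in the case \<open>t = 0\<close>, a subspace of
  dimension 3.
\<close>

section \<open>Coordinates\<close>

text \<open>By default the simplifier turns sums and products of bits into Boolean case distinctions.\<close>

declare add_bit_eq_xor [simp del] mult_bit_eq_and [simp del]

lemma UNIV_8: "(UNIV :: 8 set) = {1, 2, 3, 4, 5, 6, 7, 8}"
proof -
  have "card {1, 2, 3, 4, 5, 6, 7, 8 :: 8} = CARD(8)"
    by simp
  then show ?thesis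
    by (metis card_subset_eq finite subset_UNIV)
qed

lemma V8_eq_iff:
  "(x :: V8) = y \<longleftrightarrow> x $ 1 = y $ 1 \<and> x $ 2 = y $ 2 \<and> x $ 3 = y $ 3 \<and> x $ 4 = y $ 4 \<and>
     x $ 5 = y $ 5 \<and> x $ 6 = y $ 6 \<and> x $ 7 = y $ 7 \<and> x $ 8 = y $ 8"
proof -
  have "x = y \<longleftrightarrow> (\<forall>i \<in> UNIV. x $ i = y $ i)"
    by (simp add: vec_eq_iff)
  then show ?thesis
    unfolding UNIV_8 by simp
qed

lemma ebas_nth: "ebas i $ j = (if j = i then 1 else 0)"
  by (simp add: ebas_def axis_def)

lemma bit_add_eq_0_iff: "(a :: bit) + b = 0 \<longleftrightarrow> a = b"
  by (cases a; cases b) simp_all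

lemma bit_add_self: "(a :: bit) + a = 0"
  by (cases a) simp_all

lemma bit_add_self_left: "(a :: bit) + (a + b) = b"
  by (cases a; cases b) simp_all

text \<open>The norm of a + b\<omega> from GF(4) to GF(2); the squares in a^2 + ab + b^2 are
  invisible on bits.\<close>

definition N :: "bit \<Rightarrow> bit \<Rightarrow> bit" where
  "N a b = a * b + a + b"

text \<open>The linear part of \<open>Q\<close> supplies the squares of the norms. The orders 7, 2
  and 5, 4 follow \<open>zeta_b\<close> and \<open>zeta_d\<close>, where \<open>ebas 7\<close> and
  \<open>ebas 5\<close> play the role of 1.\<close>

lemma Q_eq_norms: "Q x = N (x $ 1) (x $ 8) + N (x $ 7) (x $ 2) + N (x $ 3) (x $ 6) + N (x $ 5) (x $ 4)"
  unfolding Q_def UNIV_8 N_def by (simp add: ac_simps)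

lemma N_eq_0_iff: "N a b = 0 \<longleftrightarrow> a = 0 \<and> b = 0"
  by (cases a; cases b) (simp_all add: N_def)

text \<open>The arguments on the left are the coordinates of \<open>(x + y\<omega>)(a + b\<omega>)\<close>.\<close>

lemma N_mult: "N (x * a + y * b) (x * b + y * (a + b)) = N x y * N a b"
  by (cases a; cases b; cases x; cases y) (simp_all add: N_def)

definition polar :: "V8 \<Rightarrow> V8 \<Rightarrow> bit" where
  "polar x y = x $ 1 * y $ 8 + x $ 8 * y $ 1 + x $ 2 * y $ 7 + x $ 7 * y $ 2
             + x $ 3 * y $ 6 + x $ 6 * y $ 3 + x $ 4 * y $ 5 + x $ 5 * y $ 4"

lemma Q_add: "Q (x + y) = Q x + Q y + polar x y"
  unfolding Q_def polar_def by (simp add: sum.distrib algebra_simps)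

lemma totally_singular_iff:
  "totally_singular U \<longleftrightarrow> vec.subspace U \<and> (\<forall>x \<in> U. Q x = 0)"
proof -
  have "Q 0 = 0"
    by (simp add: Q_def)
  then show ?thesis
    by (auto simp: totally_singular_def H7_def)
qed

lemma totally_singular_polar:
  assumes "totally_singular U" "x \<in> U" "y \<in> U"
  shows "polar x y = 0"
proof -
  have "x + y \<in> U"
    using assms by (simp add: totally_singular_iff vec.subspace_add)
  then show ?thesis
    using assms Q_add[of x y] by (simp add: totally_singular_iff)
qed

section \<open>The reduction to a single point\<close>

definition unit_point :: V8 where
  "unit_point = ebas 1 + ebas 7 + ebas 3 + ebas 5"

text \<open>The coordinatewise product in GF(4)^4: \<open>zeta_a p\<close> is \<omega> times the
  first component of \<open>p\<close>, and so on.\<close>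

definition mult :: "V8 \<Rightarrow> V8 \<Rightarrow> V8" where
  "mult p x = x $ 1 *s component 1 8 p + x $ 8 *s zeta_a p
            + x $ 7 *s component 2 7 p + x $ 2 *s zeta_b p
            + x $ 3 *s component 3 6 p + x $ 6 *s zeta_c p
            + x $ 5 *s component 4 5 p + x $ 4 *s zeta_d p"

lemma mult_nth:
  "mult p x $ 1 = x $ 1 * p $ 1 + x $ 8 * p $ 8"
  "mult p x $ 8 = x $ 1 * p $ 8 + x $ 8 * (p $ 1 + p $ 8)"
  "mult p x $ 7 = x $ 7 * p $ 7 + x $ 2 * p $ 2"
  "mult p x $ 2 = x $ 7 * p $ 2 + x $ 2 * (p $ 7 + p $ 2)"
  "mult p x $ 3 = x $ 3 * p $ 3 + x $ 6 * p $ 6"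
  "mult p x $ 6 = x $ 3 * p $ 6 + x $ 6 * (p $ 3 + p $ 6)"
  "mult p x $ 5 = x $ 5 * p $ 5 + x $ 4 * p $ 4"
  "mult p x $ 4 = x $ 5 * p $ 4 + x $ 4 * (p $ 5 + p $ 4)"
  by (simp_all add: mult_def component_def zeta_def ebas_nth)

lemma linear_mult: "Vector_Spaces.linear (*s) (*s) (mult p)"
  by unfold_locales (simp_all add: V8_eq_iff mult_nth algebra_simps)

lemma mult_unit_point: "mult p unit_point = p"
  by (simp add: V8_eq_iff mult_nth unit_point_def ebas_nth)

lemma omega4_norms:
  assumes "p \<in> omega4"
  shows "N (p $ 1) (p $ 8) = 1" "N (p $ 7) (p $ 2) = 1" "N (p $ 3) (p $ 6) = 1" "N (p $ 5) (p $ 4) = 1"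
  using assms N_eq_0_iff[of "p $ 1" "p $ 8"] N_eq_0_iff[of "p $ 7" "p $ 2"]
    N_eq_0_iff[of "p $ 3" "p $ 6"] N_eq_0_iff[of "p $ 5" "p $ 4"]
  by (auto simp: omega4_def component_def)

lemma Q_mult:
  assumes "p \<in> omega4"
  shows "Q (mult p x) = Q x"
  by (simp add: Q_eq_norms mult_nth N_mult omega4_norms[OF assms])

text \<open>Multiplication by units of norm 1 keeps the norm of each component, and only 0 has norm
  0.\<close>

lemma inj_mult:
  assumes "p \<in> omega4"
  shows "inj (mult p)"
proof -
  have "x = 0" if "mult p x = 0" for x
  proof -
    have "N (x $ 1) (x $ 8) = N (mult p x $ 1) (mult p x $ 8)"
      "N (x $ 7) (x $ 2) = N (mult p x $ 7) (mult p x $ 2)"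
      "N (x $ 3) (x $ 6) = N (mult p x $ 3) (mult p x $ 6)"
      "N (x $ 5) (x $ 4) = N (mult p x $ 5) (mult p x $ 4)"
      by (simp_all add: mult_nth N_mult omega4_norms[OF assms])
    then have "N (x $ 1) (x $ 8) = 0" "N (x $ 7) (x $ 2) = 0" "N (x $ 3) (x $ 6) = 0" "N (x $ 5) (x $ 4) = 0"
      unfolding that by (simp_all add: N_def)
    then show ?thesis
      by (simp add: N_eq_0_iff V8_eq_iff)
  qed
  then show ?thesis
    using vec.linear_inj_iff_eq_0[OF linear_mult] by blast
qed

lemma surj_mult:
  assumes "p \<in> omega4"
  shows "surj (mult p)"
  using vec.linear_inj_imp_surj[OF linear_mult inj_mult[OF assms]] .

lemma A_nth:
  "A i j k x $ n = (zeta_a ^^ i) (component 1 8 x) $ n + (zeta_b ^^ j) (component 2 7 x) $ n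
     + (zeta_c ^^ k) (component 3 6 x) $ n + zeta_d (component 4 5 x) $ n"
  by (simp add: A_def)

lemma A_nth_expanded:
  assumes "i \<in> {1, 2}" "j \<in> {1, 2}" "k \<in> {1, 2}"
  shows "A i j k x $ 1 = (if i = 1 then x $ 8 else x $ 1 + x $ 8)"
    "A i j k x $ 8 = (if i = 1 then x $ 1 + x $ 8 else x $ 1)"
    "A i j k x $ 7 = (if j = 1 then x $ 2 else x $ 7 + x $ 2)"
    "A i j k x $ 2 = (if j = 1 then x $ 7 + x $ 2 else x $ 7)"
    "A i j k x $ 3 = (if k = 1 then x $ 6 else x $ 3 + x $ 6)"
    "A i j k x $ 6 = (if k = 1 then x $ 3 + x $ 6 else x $ 3)"
    "A i j k x $ 5 = x $ 4"
    "A i j k x $ 4 = x $ 5 + x $ 4"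
  using assms
  by (auto simp: A_nth zeta_def component_def ebas_nth numeral_2_eq_2 algebra_simps)

text \<open>On each summand both maps multiply by elements of GF(4), which commute.\<close>

lemma A_mult:
  assumes "i \<in> {1, 2}" "j \<in> {1, 2}" "k \<in> {1, 2}"
  shows "A i j k (mult p x) = mult p (A i j k x)"
  by (simp add: V8_eq_iff mult_nth A_nth_expanded[OF assms] bit_add_self bit_add_self_left
      distrib_left distrib_right ac_simps)

lemma L_eq_image_mult:
  assumes "i \<in> {1, 2}" "j \<in> {1, 2}" "k \<in> {1, 2}"
  shows "L i j k p = mult p ` L i j k unit_point"
  by (simp add: L_def mult_unit_point A_mult[OF assms, symmetric])

lemma solid_eq_image_mult: "solid p = mult p ` solid unit_point"
  unfolding solid_def
  by (simp add: L_eq_image_mult[of _ _ _ p] image_Un flip: vec.linear_span_image[OF linear_mult])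

lemma solid_star_eq_image_mult: "solid_star p = mult p ` solid_star unit_point"
  unfolding solid_star_def
  by (simp add: L_eq_image_mult[of _ _ _ p] image_Un flip: vec.linear_span_image[OF linear_mult])

lemma dim_image_mult:
  assumes "p \<in> omega4"
  shows "vec.dim (mult p ` S) = vec.dim S"
  using vec.dim_image_eq[OF linear_mult] inj_mult[OF assms] inj_on_subset by blast

lemma generator_image_mult:
  assumes "p \<in> omega4" "generator S"
  shows "generator (mult p ` S)"
  unfolding generator_def
proof (intro conjI allI impI)
  show "totally_singular (mult p ` S)"
    using assms by (auto simp: generator_def totally_singular_iff Q_mult vec.linear_subspace_image[OF linear_mult])
next
  fix W
  assume W: "totally_singular W \<and> mult p ` S \<subseteq> W"
  \<comment> \<open>Maximality of \<open>S\<close> is applied to the preimage of \<open>W\<close>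
    under the isometry.\<close>
  then have "totally_singular (mult p -` W)"
    using Q_mult[OF assms(1)] vec.linear_subspace_vimage[OF linear_mult]
    by (fastforce simp: totally_singular_iff)
  then have "mult p -` W = S"
    using assms(2) W unfolding generator_def by blast
  then show "W = mult p ` S"
    using surj_mult[OF assms(1)] by (metis surj_image_vimage_eq)
qed

section \<open>The two solids of the unit point\<close>

text \<open>The parameter distinguishes the two solids: \<open>0\<close> gives \<open>\<Pi>\<close> and \<open>1\<close> gives \<open>\<Pi>\<^sup>*\<close>.\<close>

definition unit_solid :: "bit \<Rightarrow> V8 set" where
  "unit_solid \<tau> = {x. x $ 2 = x $ 8 \<and> x $ 6 = x $ 8 \<and> x $ 4 = x $ 8 \<and>
                      x $ 1 + x $ 7 + x $ 3 + x $ 5 = \<tau> * x $ 8}"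

text \<open>The parity condition is solved for coordinate 5, so that injectivity gives dimension 4.
  The first three vectors span the part t = 0.\<close>

definition unit_solid_param :: "bit \<Rightarrow> bit ^ 4 \<Rightarrow> V8" where
  "unit_solid_param \<tau> c = c $ 1 *s (ebas 1 + ebas 5) + c $ 2 *s (ebas 7 + ebas 5)
     + c $ 3 *s (ebas 3 + ebas 5) + c $ 4 *s (ebas 8 + ebas 2 + ebas 6 + ebas 4 + \<tau> *s ebas 5)"

lemma unit_solid_param_nth:
  "unit_solid_param \<tau> c $ 1 = c $ 1" "unit_solid_param \<tau> c $ 7 = c $ 2"
  "unit_solid_param \<tau> c $ 3 = c $ 3" "unit_solid_param \<tau> c $ 5 = c $ 1 + c $ 2 + c $ 3 + c $ 4 * \<tau>"
  "unit_solid_param \<tau> c $ 8 = c $ 4" "unit_solid_param \<tau> c $ 2 = c $ 4"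
  "unit_solid_param \<tau> c $ 6 = c $ 4" "unit_solid_param \<tau> c $ 4 = c $ 4"
  by (simp_all add: unit_solid_param_def ebas_nth)

lemma linear_unit_solid_param: "Vector_Spaces.linear (*s) (*s) (unit_solid_param \<tau>)"
  by unfold_locales (simp_all add: V8_eq_iff unit_solid_param_nth algebra_simps)

lemma inj_unit_solid_param: "inj (unit_solid_param \<tau>)"
  by (rule injI) (simp add: V8_eq_iff unit_solid_param_nth vec_eq_iff forall_4)

lemma bit_add_eq_iff: "(a :: bit) + b = c \<longleftrightarrow> b = a + c"
  by (cases a; cases b; cases c) simp_all

lemma unit_solid_eq_image: "unit_solid \<tau> = range (unit_solid_param \<tau>)"
proof (intro subset_antisym subsetI)
  fix x assume "x \<in> unit_solid \<tau>"
  then have x: "x $ 2 = x $ 8" "x $ 6 = x $ 8" "x $ 4 = x $ 8"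
    "x $ 5 = x $ 1 + x $ 7 + x $ 3 + \<tau> * x $ 8"
    by (simp_all add: unit_solid_def bit_add_eq_iff[of "_ + _ + _"])
  have "x = unit_solid_param \<tau> (\<chi> i. if i = 1 then x $ 1 else if i = 2 then x $ 7 else if i = 3 then x $ 3 else x $ 8)"
    by (simp add: V8_eq_iff unit_solid_param_nth x mult.commute)
  then show "x \<in> range (unit_solid_param \<tau>)"
    by blast
next
  fix x assume "x \<in> range (unit_solid_param \<tau>)"
  then show "x \<in> unit_solid \<tau>"
    by (auto simp: unit_solid_def unit_solid_param_nth bit_add_self bit_add_self_left ac_simps)
qed

lemma subspace_unit_solid: "vec.subspace (unit_solid \<tau>)"
  unfolding unit_solid_eq_image
  by (rule vec.linear_subspace_image[OF linear_unit_solid_param vec.subspace_UNIV])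

lemma dim_unit_solid: "vec.dim (unit_solid \<tau>) = 4"
  unfolding unit_solid_eq_image
  using vec.dim_image_eq[OF linear_unit_solid_param, of \<tau> UNIV] inj_unit_solid_param
  by (simp add: vec.dim_UNIV card_cart_basis)

lemma dim_unit_solid_Int: "vec.dim (unit_solid 0 \<inter> unit_solid 1) = 3"
proof -
  define f :: "bit ^ 3 \<Rightarrow> V8" where
    "f c = c $ 1 *s (ebas 1 + ebas 5) + c $ 2 *s (ebas 7 + ebas 5) + c $ 3 *s (ebas 3 + ebas 5)" for c
  have f_nth: "f c $ 1 = c $ 1" "f c $ 7 = c $ 2" "f c $ 3 = c $ 3" "f c $ 5 = c $ 1 + c $ 2 + c $ 3"
    "f c $ 8 = 0" "f c $ 2 = 0" "f c $ 6 = 0" "f c $ 4 = 0" for c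
    by (simp_all add: f_def ebas_nth)
  have "Vector_Spaces.linear (*s) (*s) f"
    by unfold_locales (simp_all add: V8_eq_iff f_nth algebra_simps)
  moreover have "inj f"
    by (rule injI) (simp add: V8_eq_iff f_nth vec_eq_iff forall_3)
  ultimately have "vec.dim (range f) = 3"
    using vec.dim_image_eq[of f UNIV] by (simp add: vec.dim_UNIV card_cart_basis)
  moreover have "unit_solid 0 \<inter> unit_solid 1 = range f"
  proof (intro subset_antisym subsetI)
    fix x assume "x \<in> unit_solid 0 \<inter> unit_solid 1"
    \<comment> \<open>Comparing the two parity conditions gives 0 = \<open>x $ 8\<close>.\<close>
    then have "x $ 8 = 0" "x $ 2 = 0" "x $ 6 = 0" "x $ 4 = 0" "x $ 5 = x $ 1 + x $ 7 + x $ 3"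
      by (auto simp: unit_solid_def bit_add_eq_iff[of "_ + _ + _" "x $ 5" 0])
    then have "x = f (vector [x $ 1, x $ 7, x $ 3])"
      by (simp add: V8_eq_iff f_nth vector_3)
    then show "x \<in> range f"
      by blast
  next
    fix x assume "x \<in> range f"
    then show "x \<in> unit_solid 0 \<inter> unit_solid 1"
      by (auto simp: unit_solid_def f_nth bit_add_self)
  qed
  ultimately show ?thesis
    by simp
qed

lemma totally_singular_unit_solid: "totally_singular (unit_solid \<tau>)"
proof -
  \<comment> \<open>With s the sum of the first arguments, the left side is st + s + 4t = s(t + 1);
    here s = t\<tau>, and t(t + 1) = 0.\<close>
  have "N a t + N b t + N c t + N (a + b + c + t * \<tau>) t = 0" for a b c t
    by (cases a; cases b; cases c; cases t; cases \<tau>) (simp_all add: N_def)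
  then show ?thesis
    unfolding totally_singular_iff
    using subspace_unit_solid[of \<tau>]
    by (auto simp: Q_eq_norms unit_solid_eq_image unit_solid_param_nth)
qed

text \<open>Testing against a basis suffices: three vectors force equal \<omega>-coordinates, the
  fourth yields the parity condition.\<close>

lemma unit_solid_polar_closed:
  assumes "\<And>y. y \<in> unit_solid \<tau> \<Longrightarrow> polar x y = 0"
  shows "x \<in> unit_solid \<tau>"
proof -
  have "polar x (ebas 1 + ebas 7) = 0" "polar x (ebas 1 + ebas 3) = 0" "polar x (ebas 1 + ebas 5) = 0"
    "polar x (ebas 8 + ebas 2 + ebas 6 + ebas 4 + \<tau> *s ebas 5) = 0"
    by (rule assms, simp add: unit_solid_def ebas_nth)+
  then have "x $ 8 + x $ 2 = 0" "x $ 8 + x $ 6 = 0" "x $ 8 + x $ 4 = 0"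
    "(x $ 1 + x $ 7 + x $ 3 + x $ 5) + \<tau> * x $ 4 = 0"
    by (simp_all add: polar_def ebas_nth ac_simps)
  then show ?thesis
    unfolding unit_solid_def bit_add_eq_0_iff by simp
qed

lemma generator_unit_solid: "generator (unit_solid \<tau>)"
  unfolding generator_def
proof (intro conjI allI impI totally_singular_unit_solid)
  fix W
  assume W: "totally_singular W \<and> unit_solid \<tau> \<subseteq> W"
  then have "x \<in> unit_solid \<tau>" if "x \<in> W" for x
    using that totally_singular_polar unit_solid_polar_closed by blast
  then show "W = unit_solid \<tau>"
    using W by blast
qed

lemma unit_point_nth:
  "unit_point $ 1 = 1" "unit_point $ 7 = 1" "unit_point $ 3 = 1" "unit_point $ 5 = 1"
  "unit_point $ 8 = 0" "unit_point $ 2 = 0" "unit_point $ 6 = 0" "unit_point $ 4 = 0"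
  by (simp_all add: unit_point_def ebas_nth)

lemma solid_unit_point: "solid unit_point = unit_solid 0"
proof (rule subset_antisym)
  show "solid unit_point \<subseteq> unit_solid 0"
    unfolding solid_def
    by (rule vec.span_minimal[OF _ subspace_unit_solid])
      (auto simp: L_def unit_solid_def A_nth_expanded unit_point_nth)
next
  \<comment> \<open>In the first bracket the exponents agree on summands a and d, where 1 + \<omega>
    + \<omega> = 1; on b and c, 1 + \<omega> + \<omega>^2 = 0. This leaves
    \<open>ebas 1 + ebas 5\<close>; the next two are analogous.\<close>
  have param: "unit_solid_param 0 c =
      c $ 1 *s (unit_point + A 1 1 1 unit_point + A 1 2 2 unit_point)
    + c $ 2 *s (unit_point + A 1 1 1 unit_point + A 2 1 2 unit_point)
    + c $ 3 *s (unit_point + A 1 1 1 unit_point + A 2 2 1 unit_point)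
    + c $ 4 *s A 1 1 1 unit_point" for c
    by (simp add: V8_eq_iff unit_solid_param_nth A_nth_expanded unit_point_nth)
  show "unit_solid 0 \<subseteq> solid unit_point"
    unfolding unit_solid_eq_image solid_def
    by (auto simp: param L_def intro!: vec.span_add vec.span_scale intro: vec.span_base)
qed

lemma solid_star_unit_point: "solid_star unit_point = unit_solid 1"
proof (rule subset_antisym)
  show "solid_star unit_point \<subseteq> unit_solid 1"
    unfolding solid_star_def
    by (rule vec.span_minimal[OF _ subspace_unit_solid])
      (auto simp: L_def unit_solid_def A_nth_expanded unit_point_nth)
next
  \<comment> \<open>The exponent on summand d is always 1, so in the last bracket a, b, c carry 1 +
    \<omega>^2 = \<omega> but d carries 1 + \<omega>: the extra \<open>ebas 5\<close>.\<close>
  have param: "unit_solid_param 1 c =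
      c $ 1 *s (unit_point + A 2 2 2 unit_point + A 2 1 1 unit_point)
    + c $ 2 *s (unit_point + A 2 2 2 unit_point + A 1 2 1 unit_point)
    + c $ 3 *s (unit_point + A 2 2 2 unit_point + A 1 1 2 unit_point)
    + c $ 4 *s (unit_point + A 2 2 2 unit_point)" for c
    by (simp add: V8_eq_iff unit_solid_param_nth A_nth_expanded unit_point_nth)
  show "unit_solid 1 \<subseteq> solid_star unit_point"
    unfolding unit_solid_eq_image solid_star_def
    by (auto simp: param L_def intro!: vec.span_add vec.span_scale intro: vec.span_base)
qed

theorem theorem3:
  fixes p :: "bit ^ 8"
  assumes "p \<in> omega4"
  shows "generator (solid p) \<and> vec.dim (solid p) = 4 \<and>
         generator (solid_star p) \<and> vec.dim (solid_star p) = 4 \<and>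
         \<not> same_system (solid p) (solid_star p)"
proof -
  have solid: "solid p = mult p ` unit_solid 0"
    using solid_eq_image_mult[of p] by (simp add: solid_unit_point)
  have star: "solid_star p = mult p ` unit_solid 1"
    using solid_star_eq_image_mult[of p] by (simp add: solid_star_unit_point)
  \<comment> \<open>The codimension 4 - 3 is odd, which separates the systems.\<close>
  have "vec.dim (solid p \<inter> solid_star p) = 3"
    unfolding solid star image_Int[OF inj_mult[OF assms], symmetric]
    by (simp add: dim_image_mult[OF assms] dim_unit_solid_Int)
  moreover have "vec.dim (solid p) = 4" "vec.dim (solid_star p) = 4"
    by (simp_all add: solid star dim_image_mult[OF assms] dim_unit_solid)
  moreover have "generator (solid p)" "generator (solid_star p)"
    by (simp_all add: solid star generator_image_mult[OF assms generator_unit_solid])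
  ultimately show ?thesis
    by (simp add: same_system_def)
qed

end
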